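(* Let $\{\psi_c\}_{c>0}$ be a multiplicative flow given by its special representation on a space $Y\times[0,r(\cdot))=\{(y,u):y\in Y,\ 0\le u<r(y)\}$ with maps $V$ and $r$, i.e. $$\psi_c(y,u)=(V^ny,\,u+\ln c-r_n(y))\quad\text{for }0\le u+\ln c-r_n(y)<r(V^ny),\ n\in\mathbb{Z}.$$ Let $\{B_c\}_{c>0}$ be a cocycle for $\{\psi_c\}_{c>0}$ taking values in $\mathbb{R}\setminus\{0\}$, and let $\{J_c\}_{c>0}$ be a semi-additive functional related to the cocycle $\{B_c\}_{c>0}$ and the flow $\{\psi_c\}_{c>0}$. Then there are functions $h:Y\times[0,r(\cdot))\to\mathbb{R}$ and $h_1:Y\to\mathbb{R}$ such that $$J_c(y,u)=J^{(1)}_c(y,u)+J^{(2)}_c(y,u)$$ for all $c>0$ and $(y,u)\in Y\times[0,r(\cdot))$, where $$J^{(1)}_c(y,u)=B_c(y,u)\,h(\psi_c(y,u))-h(y,u),$$ $$J^{(2)}_c(y,u)=(B_{e^u}(y,0))^{-1}\sum_{k\in[0,n)}B_{e^{r_k(y)}}(y,0)\,h_1(V^ky)\quad\text{for }r_n(y)\le\ln c+u<r_{n+1}(y).$$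
   Context: Special representation: $(Y,\mathcal{Y},\tau)$ is a standard Lebesgue space (standard Borel space with a $\sigma$-finite measure); $V$ is a null-isomorphism of $Y$ onto itself (a one-to-one, onto, bimeasurable map such that $\tau$ and $\tau\circ V$ have the same null sets); $r$ is a positive measurable function on $Y$ with $\sum_{k=-\infty}^{-1}r(V^ky)=\sum_{k=0}^\infty r(V^ky)=\infty$; and $r_n(y)=\sum_{k=0}^{n-1}r(V^ky)$ for $n\ge1$, $r_0(y)=0$, $r_n(y)=-\sum_{k=n}^{-1}r(V^ky)$ for $n\le-1$. The space $Y\times[0,r(\cdot))$ carries the measure $\tau(dy)du$. Convention: $\sum_{k\in[0,n)}a_k=\sum_{k=0}^{n-1}a_k$ for $n\ge1$, $=0$ for $n=0$, and $=-\sum_{k=n}^{-1}a_k$ for $n\le-1$. A multiplicative flow satisfies $\psi_{c_1c_2}(x)=\psi_{c_1}(\psi_{c_2}(x))$ for all $c_1,c_2>0$ and $\psi_1(x)=x$. A cocycle for the flow with values in $\mathbb{R}\setminus\{0\}$ is a measurable map $(c,x)\mapsto B_c(x)\in\mathbb{R}\setminus\{0\}$ on $(0,\infty)\times X$ (here $X=Y\times[0,r(\cdot))$) with $B_{c_1c_2}(x)=B_{c_1}(x)B_{c_2}(\psi_{c_1}(x))$ for all $c_1,c_2>0$, $x\in X$. A measurable map $(c,x)\mapsto J_c(x)\in\mathbb{R}$ on $(0,\infty)\times X$ is a semi-additive functional related to the cocycle $\{B_c\}$ and the flow $\{\psi_c\}$ if $J_{c_1c_2}(x)=J_{c_1}(x)+B_{c_1}(x)J_{c_2}(\psi_{c_1}(x))$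 for all $c_1,c_2>0$, $x\in X$. *)

theory Defs
  imports "HOL-Analysis.Analysis"
begin

text \<open>A measurable space is standard Borel if its \<open>\<sigma>\<close>-algebra is generated by the open sets of some
  Polish (separable, completely metrizable) topology on its carrier.  For metrizable topologies,
  second countability is equivalent to separability.\<close>

definition standard_borel_space :: "'a measure \<Rightarrow> bool" where
  "standard_borel_space M \<longleftrightarrow>
     (\<exists>T. topspace T = space M \<and> completely_metrizable_space T \<and> second_countable T \<and>
          sets M = sigma_sets (space M) {U. openin T U})"

definition standard_lebesgue_space :: "'a measure \<Rightarrow> bool" where
  "standard_lebesgue_space M \<longleftrightarrow> standard_borel_space M \<and> sigma_finite_measure M"

definition null_isomorphism :: "'a measure \<Rightarrow> ('a \<Rightarrow> 'a) \<Rightarrow> bool" where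
  "null_isomorphism M V \<longleftrightarrow>
     bij_betw V (space M) (space M) \<and>
     V \<in> measurable M M \<and> (\<forall>A\<in>sets M. V ` A \<in> sets M) \<and>
     (\<forall>A\<in>sets M. emeasure M A = 0 \<longleftrightarrow> emeasure M (V ` A) = 0)"

text \<open>Integer iterates \<open>V\<^sup>k\<close> of a bijection of \<open>S\<close> onto itself; only the values at points of \<open>S\<close>
  are meaningful.\<close>

definition int_iter :: "'a set \<Rightarrow> ('a \<Rightarrow> 'a) \<Rightarrow> int \<Rightarrow> 'a \<Rightarrow> 'a" where
  "int_iter S V k = (if 0 \<le> k then V ^^ nat k else the_inv_into S V ^^ nat (- k))"

text \<open>The sum over \<open>k \<in> [0,n)\<close> for an arbitrary integer \<open>n\<close>, with the sign convention for negative
  \<open>n\<close>; it is \<open>0\<close> for \<open>n = 0\<close>.\<close>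

definition signed_sum :: "(int \<Rightarrow> real) \<Rightarrow> int \<Rightarrow> real" where
  "signed_sum a n = (if 0 \<le> n then (\<Sum>k\<in>{0..<n}. a k) else - (\<Sum>k\<in>{n..<0}. a k))"

definition roof_sum :: "'a set \<Rightarrow> ('a \<Rightarrow> 'a) \<Rightarrow> ('a \<Rightarrow> real) \<Rightarrow> int \<Rightarrow> 'a \<Rightarrow> real" where
  "roof_sum S V r n y = signed_sum (\<lambda>k. r (int_iter S V k y)) n"

text \<open>In \<open>divergent_roof\<close> the backward sum over \<open>k \<le> -1\<close> is reindexed by \<open>k = -i - 1\<close> with
  \<open>i\<close> a natural number.\<close>

definition divergent_roof :: "'a measure \<Rightarrow> ('a \<Rightarrow> 'a) \<Rightarrow> ('a \<Rightarrow> real) \<Rightarrow> bool" where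
  "divergent_roof M V r \<longleftrightarrow>
     r \<in> borel_measurable M \<and> (\<forall>y\<in>space M. 0 < r y) \<and>
     (\<forall>y\<in>space M.
        (\<Sum>i. ennreal (r (int_iter (space M) V (- int i - 1) y))) = \<infinity> \<and>
        (\<Sum>i. ennreal (r (int_iter (space M) V (int i) y))) = \<infinity>)"

definition under_roof :: "'a measure \<Rightarrow> ('a \<Rightarrow> real) \<Rightarrow> ('a \<times> real) measure" where
  "under_roof M r =
     restrict_space (M \<Otimes>\<^sub>M lborel) {(y, u). y \<in> space M \<and> 0 \<le> u \<and> u < r y}"

definition multiplicative_flow :: "'x set \<Rightarrow> (real \<Rightarrow> 'x \<Rightarrow> 'x) \<Rightarrow> bool" where
  "multiplicative_flow X \<psi> \<longleftrightarrow>
     (\<forall>c>0. \<forall>x\<in>X. \<psi> c x \<in> X) \<and>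
     (\<forall>c\<^sub>1>0. \<forall>c\<^sub>2>0. \<forall>x\<in>X. \<psi> (c\<^sub>1 * c\<^sub>2) x = \<psi> c\<^sub>1 (\<psi> c\<^sub>2 x)) \<and>
     (\<forall>x\<in>X. \<psi> 1 x = x)"

definition flow_cocycle ::
  "'x measure \<Rightarrow> (real \<Rightarrow> 'x \<Rightarrow> 'x) \<Rightarrow> (real \<Rightarrow> 'x \<Rightarrow> real) \<Rightarrow> bool" where
  "flow_cocycle X \<psi> B \<longleftrightarrow>
     (\<lambda>(c, x). B c x) \<in> borel_measurable (restrict_space borel {0<..} \<Otimes>\<^sub>M X) \<and>
     (\<forall>c>0. \<forall>x\<in>space X. B c x \<noteq> 0) \<and>
     (\<forall>c\<^sub>1>0. \<forall>c\<^sub>2>0. \<forall>x\<in>space X. B (c\<^sub>1 * c\<^sub>2) x = B c\<^sub>1 x * B c\<^sub>2 (\<psi> c\<^sub>1 x))"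

definition semi_additive_functional ::
  "'x measure \<Rightarrow> (real \<Rightarrow> 'x \<Rightarrow> 'x) \<Rightarrow> (real \<Rightarrow> 'x \<Rightarrow> real) \<Rightarrow> (real \<Rightarrow> 'x \<Rightarrow> real) \<Rightarrow> bool" where
  "semi_additive_functional X \<psi> B J \<longleftrightarrow>
     (\<lambda>(c, x). J c x) \<in> borel_measurable (restrict_space borel {0<..} \<Otimes>\<^sub>M X) \<and>
     (\<forall>c\<^sub>1>0. \<forall>c\<^sub>2>0. \<forall>x\<in>space X. J (c\<^sub>1 * c\<^sub>2) x = J c\<^sub>1 x + B c\<^sub>1 x * J c\<^sub>2 (\<psi> c\<^sub>1 x))"

end

theory Submission
  imports Defs
begin

text \<open>A point \<open>(y, u)\<close> is \<open>\<psi>\<^bsub>e^u\<^esub>(y, 0)\<close>, so the functional is determined by its values on the base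
  \<open>Y \<times> {0}\<close>.  Take \<open>h (y, u) = J\<^bsub>e^u\<^esub>(y, 0) / B\<^bsub>e^u\<^esub>(y, 0)\<close> and \<open>h\<^sub>1 y = J\<^bsub>e^(r y)\<^esub>(y, 0)\<close>.  The path of
  length \<open>u + ln c\<close> from \<open>(y, 0)\<close> passes through \<open>(y, u)\<close> and through \<open>(V\<^sup>n y, 0)\<close>; comparing the two
  resulting decompositions leaves \<open>J\<^bsub>e^(r\<^sub>n y)\<^esub>(y, 0) / B\<^bsub>e^u\<^esub>(y, 0)\<close> as the part that is not a coboundary,
  and \<open>J\<^bsub>e^(r\<^sub>n y)\<^esub>(y, 0)\<close> telescopes in \<open>n\<close>.\<close>

lemma signed_sum_0 [simp]: "signed_sum a 0 = 0"
  by (simp add: signed_sum_def)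

text \<open>The minus sign for negative \<open>n\<close> makes one recursion valid on all integers,
  so later steps need no case split on the sign.\<close>

lemma signed_sum_plus_1: "signed_sum a (n + 1) = signed_sum a n + a n"
proof (cases "0 \<le> n")
  case True
  then have "{0..<n + 1} = insert n {0..<n}" by auto
  then show ?thesis using True by (simp add: signed_sum_def)
next
  case False
  then have "{n..<0} = insert n {n + 1..<0}" by auto
  then have "(\<Sum>k\<in>{n..<0}. a k) = a n + (\<Sum>k\<in>{n + 1..<0}. a k)" by simp
  \<comment> \<open>At \<open>n = -1\<close> the successor \<open>0\<close> falls under the other
    branch of the definition, and the remaining sum is empty.\<close>
  then show ?thesis using False by (cases "n = -1") (simp_all add: signed_sum_def)
qed

text \<open>Induction runs both ways from \<open>0\<close>; downwards the recursion is solved for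
  the earlier value. This lets the telescoping cover negative \<open>n\<close>.\<close>

lemma signed_sum_unique:
  assumes "f 0 = 0" and "\<And>n. f (n + 1) = f n + a n"
  shows "f n = signed_sum a n"
proof (induction n rule: int_induct[where k = 0])
  case base
  show ?case using assms(1) by simp
next
  case (step1 i)
  then show ?case using assms(2)[of i] by (simp add: signed_sum_plus_1)
next
  case (step2 i)
  then show ?case using assms(2)[of "i - 1"] signed_sum_plus_1[of a "i - 1"] by simp
qed

lemma roof_sum_0 [simp]: "roof_sum S V r 0 y = 0"
  by (simp add: roof_sum_def)

lemma roof_sum_plus_1: "roof_sum S V r (n + 1) y = roof_sum S V r n y + r (int_iter S V n y)"
  by (simp add: roof_sum_def signed_sum_plus_1)

lemma int_iter_0 [simp]: "int_iter S V 0 y = y"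
  by (simp add: int_iter_def)

lemma int_iter_in:
  assumes "bij_betw V S S" and "y \<in> S"
  shows "int_iter S V n y \<in> S"
proof -
  have funpow_in: "(f ^^ m) y \<in> S" if "\<And>x. x \<in> S \<Longrightarrow> f x \<in> S" for f m
    using \<open>y \<in> S\<close> that by (induction m) auto
  have "V x \<in> S" "the_inv_into S V x \<in> S" if "x \<in> S" for x
    using assms(1) that bij_betw_the_inv_into[OF assms(1)] by (auto dest: bij_betwE)
  then show ?thesis by (auto simp: int_iter_def intro: funpow_in)
qed

lemma mem_under_roof:
  "(y, u) \<in> space (under_roof M r) \<longleftrightarrow> y \<in> space M \<and> 0 \<le> u \<and> u < r y"
  by (auto simp: under_roof_def space_restrict_space space_pair_measure)

theorem corollary2p3:
  fixes Y :: "'a measure"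
    and V :: "'a \<Rightarrow> 'a"
    and r :: "'a \<Rightarrow> real"
    and \<psi> :: "real \<Rightarrow> 'a \<times> real \<Rightarrow> 'a \<times> real"
    and B J :: "real \<Rightarrow> 'a \<times> real \<Rightarrow> real"
  assumes Y: "standard_lebesgue_space Y"
    and V: "null_isomorphism Y V"
    and r: "divergent_roof Y V r"
    and flow: "multiplicative_flow (space (under_roof Y r)) \<psi>"
    and special: "\<And>c y u n. \<lbrakk>c > 0; (y, u) \<in> space (under_roof Y r);
        0 \<le> u + ln c - roof_sum (space Y) V r n y;
        u + ln c - roof_sum (space Y) V r n y < r (int_iter (space Y) V n y)\<rbrakk> \<Longrightarrow>
        \<psi> c (y, u) = (int_iter (space Y) V n y, u + ln c - roof_sum (space Y) V r n y)"
    and B: "flow_cocycle (under_roof Y r) \<psi> B"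
    and J: "semi_additive_functional (under_roof Y r) \<psi> B J"
  shows "\<exists>(h :: 'a \<times> real \<Rightarrow> real) (h\<^sub>1 :: 'a \<Rightarrow> real)
            (J\<^sub>1 :: real \<Rightarrow> 'a \<times> real \<Rightarrow> real) (J\<^sub>2 :: real \<Rightarrow> 'a \<times> real \<Rightarrow> real).
     \<forall>c>0. \<forall>y u. (y, u) \<in> space (under_roof Y r) \<longrightarrow>
       J c (y, u) = J\<^sub>1 c (y, u) + J\<^sub>2 c (y, u) \<and>
       J\<^sub>1 c (y, u) = B c (y, u) * h (\<psi> c (y, u)) - h (y, u) \<and>
       (\<forall>n::int.
          roof_sum (space Y) V r n y \<le> ln c + u \<and> ln c + u < roof_sum (space Y) V r (n + 1) y \<longrightarrow>
          J\<^sub>2 c (y, u) = inverse (B (exp u) (y, 0)) *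
            signed_sum (\<lambda>k. B (exp (roof_sum (space Y) V r k y)) (y, 0) * h\<^sub>1 (int_iter (space Y) V k y)) n)"
proof -
  let ?X = "space (under_roof Y r)"
  let ?R = "\<lambda>n y. roof_sum (space Y) V r n y"
  let ?V = "\<lambda>n y. int_iter (space Y) V n y"
  have r_pos: "0 < r y" if "y \<in> space Y" for y
    using r that by (simp add: divergent_roof_def)
  have V_in: "?V n y \<in> space Y" if "y \<in> space Y" for n y
    using V that by (intro int_iter_in) (simp_all add: null_isomorphism_def)
  have base: "(y, 0) \<in> ?X" if "y \<in> space Y" for y
    using that r_pos by (simp add: mem_under_roof)
  have B_nz: "B c x \<noteq> 0" if "c > 0" "x \<in> ?X" for c x
    using B that by (simp add: flow_cocycle_def)
  have B_mult: "B (c\<^sub>1 * c\<^sub>2) x = B c\<^sub>1 x * B c\<^sub>2 (\<psi> c\<^sub>1 x)"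
    if "c\<^sub>1 > 0" "c\<^sub>2 > 0" "x \<in> ?X" for c\<^sub>1 c\<^sub>2 x
    using B that by (simp add: flow_cocycle_def)
  have J_mult: "J (c\<^sub>1 * c\<^sub>2) x = J c\<^sub>1 x + B c\<^sub>1 x * J c\<^sub>2 (\<psi> c\<^sub>1 x)"
    if "c\<^sub>1 > 0" "c\<^sub>2 > 0" "x \<in> ?X" for c\<^sub>1 c\<^sub>2 x
    using J that by (simp add: semi_additive_functional_def)
  have J_1: "J 1 x = 0" if "x \<in> ?X" for x
  proof -
    have "\<psi> 1 x = x" using flow that by (simp add: multiplicative_flow_def)
    \<comment> \<open>The relation for \<open>1 * 1\<close> leaves \<open>B 1 x * J 1 x = 0\<close>,
      and \<open>B\<close> never vanishes.\<close>
    then show ?thesis using J_mult[of 1 1 x] B_nz[of 1 x] that by simp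
  qed
  have to_level: "\<psi> (exp u) (y, 0) = (y, u)" if "(y, u) \<in> ?X" for y u
    using special[of "exp u" y 0 0] that base by (simp add: mem_under_roof)
  \<comment> \<open>The residual height is exactly \<open>0\<close>, which is admissible because the
    roof over \<open>?V n y\<close> is positive.\<close>
  have to_base: "\<psi> (exp (?R n y)) (y, 0) = (?V n y, 0)" if "y \<in> space Y" for y n
    using special[of "exp (?R n y)" y 0 n] base[OF that] r_pos[OF V_in[OF that]] by simp
  define h where "h = (\<lambda>(y, u). J (exp u) (y, 0) / B (exp u) (y, 0))"
  define h\<^sub>1 where "h\<^sub>1 y = J (exp (r y)) (y, 0)" for y
  have telescope: "J (exp (?R n y)) (y, 0) =
      signed_sum (\<lambda>k. B (exp (?R k y)) (y, 0) * h\<^sub>1 (?V k y)) n" if y: "y \<in> space Y" for n y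
  proof (rule signed_sum_unique)
    show "J (exp (?R 0 y)) (y, 0) = 0" using J_1 base[OF y] by simp
    show "J (exp (?R (n + 1) y)) (y, 0) =
        J (exp (?R n y)) (y, 0) + B (exp (?R n y)) (y, 0) * h\<^sub>1 (?V n y)" for n
      using J_mult[of "exp (?R n y)" "exp (r (?V n y))" "(y, 0)"] base[OF y] to_base[OF y]
      by (simp add: roof_sum_plus_1 exp_add h\<^sub>1_def)
  qed
  have main: "J c (y, u) - (B c (y, u) * h (\<psi> c (y, u)) - h (y, u)) =
      inverse (B (exp u) (y, 0)) * signed_sum (\<lambda>k. B (exp (?R k y)) (y, 0) * h\<^sub>1 (?V k y)) n"
    if c: "c > 0" and yu: "(y, u) \<in> ?X" and n: "?R n y \<le> ln c + u" "ln c + u < ?R (n + 1) y"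
    for c y u n
  proof -
    have y: "y \<in> space Y" using yu by (simp add: mem_under_roof)
    note y0 = base[OF y]
    \<comment> \<open>\<open>v\<close> is the height at which the flow arrives in the column over
      \<open>?V n y\<close>; the bounds on \<open>n\<close> put it below the roof.\<close>
    define v where "v = u + ln c - ?R n y"
    have "0 \<le> v" "v < r (?V n y)" using n by (simp_all add: v_def roof_sum_plus_1)
    then have \<psi>: "\<psi> c (y, u) = (?V n y, v)" using special[OF c yu, of n] by (simp add: v_def)
    have "exp u * c = exp (u + ln c)" using c by (simp add: exp_add)
    then have times: "exp u * c = exp (?R n y) * exp v" by (simp add: v_def flip: exp_add)
    have Beq: "B (exp u) (y, 0) * B c (y, u) = B (exp (?R n y)) (y, 0) * B (exp v) (?V n y, 0)"
      using B_mult[of "exp u" c "(y, 0)"] B_mult[of "exp (?R n y)" "exp v" "(y, 0)"]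
        c y0 times to_level[OF yu] to_base[OF y, of n] by simp
    have Jeq: "J (exp u) (y, 0) + B (exp u) (y, 0) * J c (y, u) =
        J (exp (?R n y)) (y, 0) + B (exp (?R n y)) (y, 0) * J (exp v) (?V n y, 0)"
      using J_mult[of "exp u" c "(y, 0)"] J_mult[of "exp (?R n y)" "exp v" "(y, 0)"]
        c y0 times to_level[OF yu] to_base[OF y, of n] by simp
    have nz: "B (exp u) (y, 0) \<noteq> 0" "B (exp v) (?V n y, 0) \<noteq> 0"
      using B_nz y0 base[OF V_in[OF y]] by simp_all
    \<comment> \<open>By \<open>Beq\<close> the product of the two cocycle values contains
      \<open>B (exp v) (?V n y, 0)\<close>, which cancels the denominator of \<open>h\<close> at
      \<open>(?V n y, v)\<close>.\<close>
    have "B (exp u) (y, 0) * (B c (y, u) * h (\<psi> c (y, u))) =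
        B (exp (?R n y)) (y, 0) * J (exp v) (?V n y, 0)"
      using Beq nz by (simp add: \<psi> h_def flip: mult.assoc)
    moreover have "B (exp u) (y, 0) * h (y, u) = J (exp u) (y, 0)"
      using nz by (simp add: h_def)
    ultimately have "B (exp u) (y, 0) * (J c (y, u) - (B c (y, u) * h (\<psi> c (y, u)) - h (y, u))) =
        J (exp (?R n y)) (y, 0)"
      using Jeq by (simp add: right_diff_distrib)
    then show ?thesis using nz telescope[OF y, of n] by (simp add: field_simps)
  qed
  define J\<^sub>1 where "J\<^sub>1 c x = B c x * h (\<psi> c x) - h x" for c x
  show ?thesis
    \<comment> \<open>Taking the second part as the remainder \<open>J - J\<^sub>1\<close> avoids
      choosing \<open>n\<close>: \<open>main\<close> gives its formula for any \<open>n\<close>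
      within the bounds.\<close>
    by (intro exI[of _ h] exI[of _ h\<^sub>1] exI[of _ J\<^sub>1] exI[of _ "\<lambda>c x. J c x - J\<^sub>1 c x"])
      (use main in \<open>auto simp: J\<^sub>1_def\<close>)
qed

end
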